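(* For all integers $n\geq 0$ we have $$H_n\big((2^{2k+2}-1)B_{2k+2}\big)=\frac{(n+1)!}{2^{n+1}}\prod_{\ell=1}^n\ell!^4.$$
   Context: The Bernoulli numbers $B_k$ are defined by $\frac{t}{e^t-1}=\sum_{k\ge 0}B_k\frac{t^k}{k!}$. For a sequence $(c_0,c_1,\ldots)$ (indexed from $k=0$), $H_n(c_k)=\det\big(c_{i+j}\big)_{0\le i,j\le n}$; here $c_k=(2^{2k+2}-1)B_{2k+2}$. $\ell!^4=(\ell!)^4$, and empty products equal $1$. *)

theory Defs
  imports
    "HOL-Computational_Algebra.Formal_Power_Series"
    "Jordan_Normal_Form.Determinant"
begin

(* The quotient is division of formal power series over a field, which cancels the common
   factor fps_X; see bernoulli_egf. The convention is the one with value -1/2 at index 1. *)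
definition bernoulli :: "nat \<Rightarrow> rat" where
  "bernoulli k = fact k * fps_nth (fps_X / (fps_exp 1 - 1)) k"

lemma bernoulli_egf:
  "Abs_fps (\<lambda>k. bernoulli k / fact k) * (fps_exp 1 - 1) = fps_X"
proof -
  have eq: "Abs_fps (\<lambda>k. bernoulli k / fact k) = fps_X / (fps_exp 1 - 1)"
    by (rule fps_ext) (simp add: bernoulli_def)
  have nz: "fps_nth (fps_exp (1::rat) - 1) 1 \<noteq> 0"
    by simp
  then have "fps_exp (1::rat) - 1 \<noteq> 0" and "subdegree (fps_exp (1::rat) - 1) \<le> 1"
    by (auto intro: subdegree_leI)
  then have "(fps_exp (1::rat) - 1) dvd fps_X"
    by (subst fps_dvd_iff) auto
  with eq show ?thesis
    by simp
qed

(* Index n gives the determinant of size n + 1. *)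
definition hankel_det :: "(nat \<Rightarrow> 'a::comm_ring_1) \<Rightarrow> nat \<Rightarrow> 'a" where
  "hankel_det c n = det (mat (n + 1) (n + 1) (\<lambda>(i, j). c (i + j)))"

end

(* Let N be the linear functional on polynomials with N(x^k) = (2^k - 1) B_k. The generating
   function of its moments is -t / (e^t + 1), which says N(p(x + 1) + p(x)) = - p'(0). The
   Hankel determinant is the Gram determinant of L(p) = N(x^2 p(x^2)) in any two families of
   monic polynomials, and we take A_i(y) = (y - 1^2) ... (y - i^2) and
   C_j(y) = (y - 0^2) ... (y - (j - 1)^2), two bases suggested by the continuous dual Hahn
   polynomials. Applying the identity for N to x^2 (x - 1) (x - j - 1) A_j(x^2) gives
   L(A_{j+1}) = - (j + 1) (j + 2) L(A_j), and from there induction on j gives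
   L(A_i C_j) = (-1)^(i+j) (i + j)! (i + 1)! j! / 2. Up to row and column factors this is the
   symmetric Pascal matrix, whose determinant is 1. *)
theory Submission
  imports Defs
begin

section \<open>Hankel determinants as Gram determinants\<close>

text \<open>The matrix factors as Q H R^T with Q and R lower triangular, and \<open>det\<close> is
  multiplicative. This serves both the change of polynomial bases and the factorization of the
  Pascal matrix.\<close>

lemma det_lower_triangular_congruence:
  fixes H :: "nat \<Rightarrow> nat \<Rightarrow> 'a::comm_ring_1"
  assumes Q: "\<And>i a. i < a \<Longrightarrow> Q i a = 0" and R: "\<And>j b. j < b \<Longrightarrow> R j b = 0"
  shows "det (mat N N (\<lambda>(i, j). \<Sum>a<N. \<Sum>b<N. Q i a * H a b * R j b))
    = (\<Prod>i<N. Q i i) * det (mat N N (\<lambda>(i, j). H i j)) * (\<Prod>j<N. R j j)"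
proof -
  define q where "q = mat N N (\<lambda>(i, j). Q i j)"
  define h where "h = mat N N (\<lambda>(i, j). H i j)"
  define r where "r = mat N N (\<lambda>(i, j). R i j)"
  have carr: "q \<in> carrier_mat N N" "h \<in> carrier_mat N N" "r \<in> carrier_mat N N"
    by (auto simp: q_def h_def r_def)
  have "mat N N (\<lambda>(i, j). \<Sum>a<N. \<Sum>b<N. Q i a * H a b * R j b) = q * (h * transpose_mat r)"
    by (rule eq_matI)
      (auto simp: q_def h_def r_def scalar_prod_def sum_distrib_left mult.assoc atLeast0LessThan)
  moreover have "det (q * (h * transpose_mat r)) = det q * det h * det r"
    using carr by (simp add: det_mult[where n = N] det_transpose mult.assoc)
  moreover have "det q = (\<Prod>i<N. Q i i)"
    using det_lower_triangular[OF _ carr(1)] Q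
    by (simp add: q_def prod_list_diag_prod atLeast0LessThan)
  moreover have "det r = (\<Prod>j<N. R j j)"
    using det_lower_triangular[OF _ carr(3)] R
    by (simp add: r_def prod_list_diag_prod atLeast0LessThan)
  ultimately show ?thesis
    by (simp add: h_def)
qed

text \<open>The linear functional on polynomials that sends x^k to \<open>c k\<close>.\<close>

definition moment :: "(nat \<Rightarrow> 'a) \<Rightarrow> 'a poly \<Rightarrow> 'a::comm_ring_1" where
  "moment c p = (\<Sum>i\<le>degree p. coeff p i * c i)"

lemma moment_eq_sum:
  assumes "degree p \<le> n"
  shows "moment c p = (\<Sum>i\<le>n. coeff p i * c i)"
  unfolding moment_def using assms
  by (intro sum.mono_neutral_left) (auto simp: coeff_eq_0)

lemma moment_add: "moment c (p + q) = moment c p + moment c q"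
proof -
  define n where "n = max (degree p) (degree q)"
  have "degree (p + q) \<le> n" "degree p \<le> n" "degree q \<le> n"
    by (auto simp: n_def degree_add_le)
  then show ?thesis
    by (simp add: moment_eq_sum[where n = n] sum.distrib algebra_simps)
qed

lemma moment_0: "moment c 0 = 0"
  by (simp add: moment_def)

lemma moment_smult: "moment c (smult a p) = a * moment c p"
  by (subst moment_eq_sum[OF degree_smult_le]) (simp add: moment_def sum_distrib_left mult.assoc)

lemma moment_sum: "moment c (sum f A) = (\<Sum>x\<in>A. moment c (f x))"
  by (induction A rule: infinite_finite_induct) (auto simp: moment_0 moment_add)

lemma moment_monom: "moment c (monom a k) = a * c k"
  by (simp add: moment_eq_sum[OF degree_monom_le] if_distrib [of "\<lambda>x. x * _"] cong: if_cong)

lemma moment_mult: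
  assumes "degree p \<le> m" "degree q \<le> n"
  shows "moment c (p * q) = (\<Sum>a\<le>m. \<Sum>b\<le>n. coeff p a * coeff q b * c (a + b))"
proof -
  have "p * q = (\<Sum>a\<le>m. monom (coeff p a) a) * (\<Sum>b\<le>n. monom (coeff q b) b)"
    using assms by (simp add: poly_as_sum_of_monoms')
  also have "\<dots> = (\<Sum>a\<le>m. \<Sum>b\<le>n. monom (coeff p a * coeff q b) (a + b))"
    by (simp add: sum_product mult_monom)
  finally show ?thesis
    by (simp add: moment_sum moment_monom)
qed

text \<open>Both coefficient matrices are lower triangular with unit diagonal, so replacing the
  monomials by \<open>p\<close> on rows and \<open>q\<close> on columns keeps the determinant.
  Allowing two different families is what gives closed-form entries later.\<close>

lemma hankel_det_monic_bases:
  fixes p q :: "nat \<Rightarrow> 'a::comm_ring_1 poly"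
  assumes p: "\<And>i. degree (p i) = i" "\<And>i. lead_coeff (p i) = 1"
    and q: "\<And>i. degree (q i) = i" "\<And>i. lead_coeff (q i) = 1"
  shows "hankel_det c n = det (mat (n + 1) (n + 1) (\<lambda>(i, j). moment c (p i * q j)))"
proof -
  have "mat (n + 1) (n + 1) (\<lambda>(i, j). moment c (p i * q j))
      = mat (n + 1) (n + 1)
          (\<lambda>(i, j). \<Sum>a<n + 1. \<Sum>b<n + 1. coeff (p i) a * c (a + b) * coeff (q j) b)"
    by (rule eq_matI)
      (auto simp: p q lessThan_Suc_atMost moment_mult[where m = n and n = n] mult_ac)
  also have "det \<dots> = hankel_det c n"
    using p q
    by (subst det_lower_triangular_congruence) (auto simp: hankel_det_def coeff_eq_0)
  finally show ?thesis ..
qed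

section \<open>The symmetric Pascal matrix\<close>

text \<open>Vandermonde's identity, read as the factorization L L^T of the Pascal matrix with L the
  triangle of binomial coefficients. The bound \<open>n\<close>, common to all rows, makes the sum a
  product of matrices of fixed size.\<close>

lemma binomial_add_eq_sum:
  assumes "i \<le> n"
  shows "(i + j) choose i = (\<Sum>k\<le>n. (i choose k) * (j choose k))"
proof -
  have "(i + j) choose i = (\<Sum>k\<le>i. (j choose k) * (i choose (i - k)))"
    by (subst vandermonde) (simp add: add.commute)
  also have "\<dots> = (\<Sum>k\<le>i. (i choose k) * (j choose k))"
    by (intro sum.cong) (auto simp: binomial_symmetric[symmetric])
  also have "\<dots> = (\<Sum>k\<le>n. (i choose k) * (j choose k))"
    using assms by (intro sum.mono_neutral_left) auto
  finally show ?thesis .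
qed

text \<open>The scalars are absorbed into the rows of the two triangular factors, whose diagonals
  become \<open>x i\<close> and \<open>y j\<close>.\<close>

lemma det_scaled_binomial:
  fixes x y :: "nat \<Rightarrow> 'a::comm_ring_1"
  shows "det (mat (n + 1) (n + 1) (\<lambda>(i, j). x i * y j * of_nat ((i + j) choose i)))
    = (\<Prod>i\<le>n. x i) * (\<Prod>j\<le>n. y j)"
proof -
  \<comment> \<open>An identity matrix is put between the two factors to obtain the double sum of
    \<open>det_lower_triangular_congruence\<close>.\<close>
  let ?\<delta> = "\<lambda>a b. if a = b then 1 else 0 :: 'a"
  have diagonal: "(\<Sum>b<n + 1. u * ?\<delta> a b * v b) = u * v a" if "a < n + 1" for a u v
  proof -
    have "(\<Sum>b<n + 1. u * ?\<delta> a b * v b) = (\<Sum>b<n + 1. if a = b then u * v b else 0)"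
      by (rule sum.cong) auto
    with that show ?thesis
      by simp
  qed
  have "x i * y j * of_nat ((i + j) choose i) = (\<Sum>a<n + 1. \<Sum>b<n + 1.
      (x i * of_nat (i choose a)) * ?\<delta> a b * (y j * of_nat (j choose b)))" if "i \<le> n" for i j
  proof -
    have "x i * y j * of_nat ((i + j) choose i)
        = (\<Sum>a<n + 1. (x i * of_nat (i choose a)) * (y j * of_nat (j choose a)))"
      unfolding binomial_add_eq_sum[OF that]
      by (simp add: lessThan_Suc_atMost sum_distrib_left mult_ac del: sum.lessThan_Suc)
    also have "\<dots> = (\<Sum>a<n + 1. \<Sum>b<n + 1.
        (x i * of_nat (i choose a)) * ?\<delta> a b * (y j * of_nat (j choose b)))"
      by (rule sum.cong[OF refl], rule diagonal[symmetric]) simp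
    finally show ?thesis .
  qed
  then have "mat (n + 1) (n + 1) (\<lambda>(i, j). x i * y j * of_nat ((i + j) choose i))
      = mat (n + 1) (n + 1) (\<lambda>(i, j). \<Sum>a<n + 1. \<Sum>b<n + 1.
          (x i * of_nat (i choose a)) * ?\<delta> a b * (y j * of_nat (j choose b)))"
    (is "?M = ?N")
    by (intro eq_matI) (simp_all only: index_mat prod.case dim_row_mat dim_col_mat)
  then have "det ?M = det ?N"
    by (rule arg_cong)
  also have "\<dots> = (\<Prod>i<n + 1. x i * of_nat (i choose i))
      * det (mat (n + 1) (n + 1) (\<lambda>(i, j). ?\<delta> i j)) * (\<Prod>j<n + 1. y j * of_nat (j choose j))"
    by (rule det_lower_triangular_congruence) (simp_all add: binomial_eq_0)
  also have "\<dots> = (\<Prod>i\<le>n. x i) * det (1\<^sub>m (n + 1) :: 'a mat) * (\<Prod>j\<le>n. y j)"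
    by (simp add: lessThan_Suc_atMost one_mat_def)
  finally show ?thesis
    by simp
qed

section \<open>The functional N and its shift identity\<close>

text \<open>These are the Genocchi numbers 2 (1 - 2^k) B_k multiplied by -1/2.\<close>

definition genocchi_moment :: "nat \<Rightarrow> rat" where
  "genocchi_moment k = (2 ^ k - 1) * bernoulli k"

text \<open>With B(t) = t / (e^t - 1), the series is B(2t) - B(t), and e^(2t) - 1 = (e^t - 1) (e^t +
  1).\<close>

lemma genocchi_moment_egf:
  "Abs_fps (\<lambda>k. genocchi_moment k / fact k) * (fps_exp 1 + 1) = - fps_X"
proof -
  define B where "B = Abs_fps (\<lambda>k. bernoulli k / fact k)"
  have B: "B * (fps_exp 1 - 1) = fps_X"
    unfolding B_def by (rule bernoulli_egf)
  have "B oo (fps_const 2 * fps_X) = Abs_fps (\<lambda>k. 2 ^ k * (bernoulli k / fact k))"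
    by (simp add: fps_compose_linear B_def)
  then have S: "Abs_fps (\<lambda>k. genocchi_moment k / fact k) = (B oo (fps_const 2 * fps_X)) - B"
    by (intro fps_ext) (simp add: B_def genocchi_moment_def field_simps)
  have "(B * (fps_exp 1 - 1)) oo (fps_const 2 * fps_X)
      = (B oo (fps_const 2 * fps_X)) * (fps_exp 2 - 1)"
    by (simp add: fps_compose_mult_distrib fps_compose_sub_distrib)
  moreover have "fps_exp (2::rat) = fps_exp 1 * fps_exp 1"
    by (simp flip: fps_exp_add_mult)
  ultimately have B2: "(B oo (fps_const 2 * fps_X)) * (fps_exp 1 * fps_exp 1 - 1)
      = fps_const 2 * fps_X"
    by (simp add: B)
  \<comment> \<open>The extra factor e^t - 1 makes both defining equations for B applicable; being
    nonzero, it is cancelled at the end.\<close>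
  have "((B oo (fps_const 2 * fps_X)) - B) * (fps_exp 1 + 1) * (fps_exp 1 - 1)
      = (B oo (fps_const 2 * fps_X)) * (fps_exp 1 * fps_exp 1 - 1)
        - B * (fps_exp 1 - 1) * (fps_exp 1 + 1)"
    by (simp add: algebra_simps)
  also have "\<dots> = fps_const 2 * fps_X - fps_X * (fps_exp 1 + 1)"
    by (simp only: B B2)
  also have "\<dots> = - fps_X * (fps_exp 1 - 1)"
    by (simp add: algebra_simps flip: numeral_fps_const)
  finally have "((B oo (fps_const 2 * fps_X)) - B) * (fps_exp 1 + 1) * (fps_exp 1 - 1)
      = - fps_X * (fps_exp 1 - 1)" .
  moreover have "fps_exp (1::rat) - 1 \<noteq> 0"
    using B by auto
  ultimately show ?thesis
    unfolding S using mult_right_cancel by blast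
qed

lemma genocchi_moment_recurrence:
  "(\<Sum>k\<le>n. of_nat (n choose k) * genocchi_moment k) + genocchi_moment n
    = (if n = 1 then - 1 else 0)"
proof -
  have "(\<Sum>k\<le>n. genocchi_moment k / fact k / fact (n - k)) + genocchi_moment n / fact n
      = fps_nth (- fps_X) n"
    unfolding genocchi_moment_egf[symmetric]
    by (simp add: distrib_left fps_mult_nth atLeast0AtMost)
  then have "fact n * ((\<Sum>k\<le>n. genocchi_moment k / fact k / fact (n - k))
      + genocchi_moment n / fact n) = (if n = 1 then - 1 else 0)"
    by simp
  moreover have "fact n * (\<Sum>k\<le>n. genocchi_moment k / fact k / fact (n - k))
      = (\<Sum>k\<le>n. of_nat (n choose k) * genocchi_moment k)"
    unfolding sum_distrib_left
    by (intro sum.cong) (auto simp: binomial_fact)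
  ultimately show ?thesis
    by (simp add: distrib_left)
qed

text \<open>For p = x^n, expanding (x + 1)^n turns this into
  \<open>genocchi_moment_recurrence\<close>; linearity gives the rest.\<close>

lemma moment_genocchi_shift:
  "moment genocchi_moment (pcompose p [:1, 1:] + p) = - coeff p 1"
proof -
  have shift: "moment genocchi_moment (pcompose (monom a n) [:1, 1:] + monom a n)
      = - coeff (monom a n) 1" for a n
  proof -
    have "[:1, 1:] ^ n = (monom 1 1 + 1 :: rat poly) ^ n"
      by (simp add: monom_altdef one_pCons)
    also have "\<dots> = (\<Sum>k\<le>n. monom (of_nat (n choose k)) k)"
      by (simp add: binomial_ring monom_power of_nat_poly smult_monom)
    finally have power: "[:1, 1:] ^ n = (\<Sum>k\<le>n. monom (of_nat (n choose k)) k :: rat poly)" .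
    have "pcompose (monom a n) [:1, 1:] = smult a ([:1, 1:] ^ n)"
      by (rule poly_ext) (simp add: poly_pcompose poly_monom)
    then have "moment genocchi_moment (pcompose (monom a n) [:1, 1:] + monom a n)
        = a * ((\<Sum>k\<le>n. of_nat (n choose k) * genocchi_moment k) + genocchi_moment n)"
      by (simp only: power moment_add moment_smult moment_sum moment_monom distrib_left)
    then show ?thesis
      unfolding genocchi_moment_recurrence by simp
  qed
  define f where "f = (\<lambda>i. monom (coeff p i) i)"
  have p: "(\<Sum>i\<le>degree p. f i) = p"
    by (simp add: f_def poly_as_sum_of_monoms)
  have "pcompose (\<Sum>i\<le>degree p. f i) [:1, 1:] + (\<Sum>i\<le>degree p. f i)
      = (\<Sum>i\<le>degree p. pcompose (f i) [:1, 1:] + f i)"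
    by (simp only: pcompose_sum sum.distrib)
  also have "moment genocchi_moment \<dots> = - coeff (\<Sum>i\<le>degree p. f i) 1"
    unfolding moment_sum f_def shift by (simp add: coeff_sum sum_negf)
  finally show ?thesis
    unfolding p .
qed

section \<open>Products with nodes at consecutive squares\<close>

text \<open>In the notation of the header, \<open>A\<^sub>j\<close> is \<open>square_nodes 1 j\<close>
  and \<open>C\<^sub>j\<close> is \<open>square_nodes 0 j\<close>.\<close>
definition square_nodes :: "nat \<Rightarrow> nat \<Rightarrow> rat poly" where
  "square_nodes a j = (\<Prod>l<j. [:- (of_nat (a + l) ^ 2), 1:])"

lemma square_nodes_0: "square_nodes a 0 = 1"
  and square_nodes_Suc: "square_nodes a (Suc j)
    = [:- (of_nat (a + j) ^ 2), 1:] * square_nodes a j"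
  by (simp_all add: square_nodes_def mult.commute)

lemma degree_square_nodes: "degree (square_nodes a j) = j"
  unfolding square_nodes_def by (subst degree_prod_eq_sum_degree) auto

lemma lead_coeff_square_nodes: "lead_coeff (square_nodes a j) = 1"
  unfolding square_nodes_def by (subst lead_coeff_prod) auto

text \<open>After multiplication by \<open>x\<close>, \<open>A\<^sub>j(x\<^sup>2)\<close> is the product of \<open>x - j, \<dots>, x + j\<close>;
  the factors on both sides avoid a division.\<close>
lemma poly_square_nodes_shift:
  "(x + 1) * (x - of_nat j) * poly (square_nodes 1 j) ((x + 1)\<^sup>2)
    = x * (x + of_nat j + 1) * poly (square_nodes 1 j) (x\<^sup>2)"
proof (induction j)
  case 0
  then show ?case by (simp add: square_nodes_0)
next
  case (Suc j)
  have "(x + 1) * (x - of_nat (Suc j)) * poly (square_nodes 1 (Suc j)) ((x + 1)\<^sup>2)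
      = (x - of_nat j - 1) * (x + of_nat j + 2)
        * ((x + 1) * (x - of_nat j) * poly (square_nodes 1 j) ((x + 1)\<^sup>2))"
    by (simp add: square_nodes_Suc algebra_simps power2_eq_square)
  also have "\<dots> = x * (x + of_nat (Suc j) + 1) * poly (square_nodes 1 (Suc j)) (x\<^sup>2)"
    unfolding Suc.IH by (simp add: square_nodes_Suc algebra_simps power2_eq_square)
  finally show ?case .
qed

section \<open>The functional L and the entries of the Gram matrix\<close>

definition even_moment :: "nat \<Rightarrow> rat" where
  "even_moment k = genocchi_moment (2 * k + 2)"

text \<open>The substitution y = x^2 doubles the index, and the factor x^2 supplies the shift by
  2.\<close>

lemma moment_even:
  "moment even_moment p = moment genocchi_moment (monom 1 2 * pcompose p (monom 1 2))"
proof -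
  have monom: "monom 1 2 * pcompose (monom a k) (monom 1 2) = monom a (2 * k + 2)"
    for a :: rat and k
    by (rule poly_ext) (simp add: poly_pcompose poly_monom power_mult power2_eq_square)
  have "monom 1 2 * pcompose (\<Sum>k\<le>degree p. monom (coeff p k) k) (monom 1 2)
      = (\<Sum>k\<le>degree p. monom (coeff p k) (2 * k + 2))"
    by (simp only: pcompose_sum sum_distrib_left monom)
  then have "monom 1 2 * pcompose p (monom 1 2)
      = (\<Sum>k\<le>degree p. monom (coeff p k) (2 * k + 2))"
    by (simp only: poly_as_sum_of_monoms)
  then show ?thesis
    by (simp add: moment_sum moment_monom) (simp add: moment_def even_moment_def)
qed

lemma bernoulli_2: "bernoulli 2 = 1 / 6"
proof -
  have "fps_nth (Abs_fps (\<lambda>k. bernoulli k / fact k) * (fps_exp 1 - 1)) n = fps_nth fps_X n" for n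
    by (simp only: bernoulli_egf)
  \<comment> \<open>The coefficients of t, t^2 and t^3 determine B_0, B_1 and B_2 in turn.\<close>
  note coeffs = this[unfolded fps_mult_nth, simplified]
  have "bernoulli 0 = 1"
    using coeffs[of 1] by simp
  moreover have "bernoulli 1 = - 1 / 2"
    using coeffs[of 2] calculation by (simp add: numeral_eq_Suc)
  ultimately show ?thesis
    using coeffs[of 3] by (simp add: numeral_eq_Suc)
qed

text \<open>The polynomial \<open>q\<close> is chosen so that q(x + 1) = q(-x). Hence q(x + 1) +
  q(x) is even, and N of it is a value of L.\<close>

lemma moment_square_nodes_Suc:
  "moment even_moment (square_nodes 1 (Suc j))
    = - of_nat ((j + 1) * (j + 2)) * moment even_moment (square_nodes 1 j)"
proof -
  define r where "r = square_nodes 1 j"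
  define q where
    "q = monom 1 2 * ([:-1, 1:] * [:- of_nat (j + 1), 1:] * pcompose r (monom 1 2))"
  have q: "poly q z = z\<^sup>2 * ((z - 1) * (z - of_nat j - 1) * poly r (z\<^sup>2))" for z
    by (simp add: q_def poly_pcompose poly_monom algebra_simps)
  have s: "poly (square_nodes 1 (Suc j)) z = (z - (1 + of_nat j)\<^sup>2) * poly r z" for z
    by (simp add: square_nodes_Suc r_def left_diff_distrib)
  have "pcompose q [:1, 1:] + q = smult 2 (monom 1 2 * pcompose (square_nodes 1 (Suc j)
      + smult (of_nat ((j + 1) * (j + 2))) r) (monom 1 2))"
  proof (rule poly_ext)
    fix x :: rat
    define v where "v = poly r (x\<^sup>2)"
    have "poly (pcompose q [:1, 1:]) x = poly q (x + 1)"
      by (simp add: poly_pcompose add.commute)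
    \<comment> \<open>One of the two factors x + 1 stays outside, so that the rest is the left side
      of \<open>poly_square_nodes_shift\<close>.\<close>
    also have "\<dots> = x * (x + 1) * ((x + 1) * (x - of_nat j) * poly r ((x + 1)\<^sup>2))"
      unfolding q by (simp add: power2_eq_square[of "x + 1"] mult_ac)
    also have "\<dots> = x\<^sup>2 * (x + 1) * (x + of_nat j + 1) * v"
      unfolding r_def v_def poly_square_nodes_shift by (simp add: power2_eq_square)
    finally have "poly (pcompose q [:1, 1:] + q) x
        = x\<^sup>2 * (x + 1) * (x + of_nat j + 1) * v + x\<^sup>2 * ((x - 1) * (x - of_nat j - 1) * v)"
      by (simp add: q v_def)
    \<comment> \<open>The sum is 2 x^2 (x^2 + j + 1) \<open>v\<close>, and x^2 + j + 1 = (x^2 - (j +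
      1)^2) + (j + 1) (j + 2).\<close>
    also have "\<dots> = 2 * (x\<^sup>2 * ((x\<^sup>2 - (1 + of_nat j)\<^sup>2) * v
        + of_nat ((j + 1) * (j + 2)) * v))"
      by (simp add: algebra_simps power2_eq_square)
    also have "\<dots> = poly (smult 2 (monom 1 2 * pcompose
        (square_nodes 1 (Suc j) + smult (of_nat ((j + 1) * (j + 2))) r) (monom 1 2))) x"
      by (simp only: s poly_pcompose poly_monom v_def poly_smult poly_mult poly_add mult_1)
    finally show "poly (pcompose q [:1, 1:] + q) x = \<dots>" .
  qed
  \<comment> \<open>The factor x^2 of \<open>q\<close> makes the right side of the shift identity
    vanish.\<close>
  moreover have "coeff q 1 = 0"
    by (simp add: q_def coeff_monom_mult)
  ultimately have "2 * moment even_moment (square_nodes 1 (Suc j)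
      + smult (of_nat ((j + 1) * (j + 2))) r) = 0"
    using moment_genocchi_shift[of q] by (simp only: moment_smult moment_even)
  then have "moment even_moment (square_nodes 1 (Suc j))
      + of_nat ((j + 1) * (j + 2)) * moment even_moment r = 0"
    by (simp only: moment_add moment_smult mult_eq_0_iff) simp
  then show ?thesis
    by (simp only: r_def eq_neg_iff_add_eq_0 mult_minus_left)
qed

lemma moment_square_nodes:
  "moment even_moment (square_nodes 1 j) = (- 1) ^ j * fact j * fact (j + 1) / 2"
proof (induction j)
  case 0
  \<comment> \<open>The base value is L(1) = (2^2 - 1) B_2 = 1/2.\<close>
  show ?case
    by (simp add: square_nodes_0 moment_def even_moment_def genocchi_moment_def
        bernoulli_2[unfolded numeral_2_eq_2])
next
  case (Suc j)
  show ?case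
    unfolding moment_square_nodes_Suc Suc.IH by (simp add: field_simps)
qed

text \<open>Writing y - j^2 = (y - (i + 1)^2) + ((i + 1)^2 - j^2) trades the last factor of C_{j+1}
  for one more factor of A_i. The index \<open>i\<close> therefore has to vary in the
  induction.\<close>

lemma moment_square_nodes_mult:
  "moment even_moment (square_nodes 1 i * square_nodes 0 j)
    = (- 1) ^ (i + j) * fact (i + j) * fact (i + 1) * fact j / 2"
proof (induction j arbitrary: i)
  case 0
  show ?case
    by (simp add: square_nodes_0 moment_square_nodes[simplified])
next
  case (Suc j)
  have "square_nodes 1 i * square_nodes 0 (Suc j) = square_nodes 1 (Suc i) * square_nodes 0 j
      + smult ((of_nat i + 1)\<^sup>2 - (of_nat j)\<^sup>2) (square_nodes 1 i * square_nodes 0 j)"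
    by (rule poly_ext) (simp add: square_nodes_Suc algebra_simps power2_eq_square)
  then have "moment even_moment (square_nodes 1 i * square_nodes 0 (Suc j))
      = moment even_moment (square_nodes 1 (Suc i) * square_nodes 0 j)
        + ((of_nat i + 1)\<^sup>2 - (of_nat j)\<^sup>2)
          * moment even_moment (square_nodes 1 i * square_nodes 0 j)"
    by (simp only: moment_add moment_smult)
  \<comment> \<open>After common factors are removed, this is (i + j + 1) (i + 2) - (i + 1 - j) (i +
    1 + j) = (i + j + 1) (j + 1).\<close>
  also have "\<dots> = (- 1) ^ (i + Suc j) * fact (i + Suc j) * fact (i + 1) * fact (Suc j) / 2"
    unfolding Suc.IH by (simp add: field_simps power2_eq_square)
  finally show ?case .
qed

theorem corollary5p3:
  fixes n :: nat
  shows "hankel_det (\<lambda>k. (2 ^ (2 * k + 2) - 1) * bernoulli (2 * k + 2)) n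
    = fact (n + 1) / 2 ^ (n + 1) * (\<Prod>l = 1..n. fact l ^ 4)"
proof -
  \<comment> \<open>Since (i + j)! is i! j! times a binomial coefficient, each Gram entry splits
    into a row factor, a column factor and an entry of the Pascal matrix.\<close>
  define x y :: "nat \<Rightarrow> rat"
    where "x = (\<lambda>i. (- 1) ^ i * fact i * fact (i + 1) / 2)"
      and "y = (\<lambda>j. (- 1) ^ j * fact j * fact j)"
  have "(\<lambda>k. (2 ^ (2 * k + 2) - 1) * bernoulli (2 * k + 2)) = even_moment"
    by (simp add: fun_eq_iff even_moment_def genocchi_moment_def)
  moreover have "hankel_det even_moment n = det (mat (n + 1) (n + 1)
      (\<lambda>(i, j). moment even_moment (square_nodes 1 i * square_nodes 0 j)))"
    by (rule hankel_det_monic_bases) (rule degree_square_nodes lead_coeff_square_nodes)+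
  moreover have "moment even_moment (square_nodes 1 i * square_nodes 0 j)
      = x i * y j * of_nat ((i + j) choose i)" for i j
    unfolding moment_square_nodes_mult
    by (simp add: x_def y_def binomial_fact power_add)
  moreover have "(\<Prod>i\<le>n. x i) * (\<Prod>j\<le>n. y j)
      = fact (n + 1) / 2 ^ (n + 1) * (\<Prod>l = 1..n. fact l ^ 4)"
  proof (induction n)
    case 0
    show ?case by (simp add: x_def y_def)
  next
    case (Suc n)
    \<comment> \<open>The signs cancel, and with m = n + 1 the factorials m!, (m + 1)!, m!, m!
      combine to (m + 1) m!^4.\<close>
    have "x (Suc n) * y (Suc n) = (of_nat n + 2) / 2 * fact (Suc n) ^ 4"
      by (simp add: x_def y_def power_mult_distrib[symmetric] field_simps power4_eq_xxxx)
    moreover have "(\<Prod>i\<le>Suc n. x i) * (\<Prod>j\<le>Suc n. y j)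
        = ((\<Prod>i\<le>n. x i) * (\<Prod>j\<le>n. y j)) * (x (Suc n) * y (Suc n))"
      by simp
    ultimately have "(\<Prod>i\<le>Suc n. x i) * (\<Prod>j\<le>Suc n. y j)
        = fact (n + 1) / 2 ^ (n + 1) * (\<Prod>l = 1..n. fact l ^ 4)
          * ((of_nat n + 2) / 2 * fact (Suc n) ^ 4)"
      by (simp only: Suc.IH)
    also have "\<dots> = ((of_nat n + 2) * fact (n + 1)) / 2 ^ (Suc n + 1)
        * ((\<Prod>l = 1..n. fact l ^ 4) * fact (Suc n) ^ 4)"
      by simp
    also have "(of_nat n + 2) * fact (n + 1) = (fact (Suc n + 1) :: rat)"
      by (simp add: algebra_simps)
    also have "(\<Prod>l = 1..n. fact l ^ 4) * fact (Suc n) ^ 4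
        = (\<Prod>l = 1..Suc n. fact l ^ 4 :: rat)"
      by simp
    finally show ?case .
  qed
  ultimately show ?thesis
    by (simp only: det_scaled_binomial)
qed

end
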